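(* Let $\mathcal{X}$ be a standard Borel space and let $T:\mathcal{X}\to\mathbb{R}$ be a (measurable) function. Consider a Bayesian model consisting of a prior $\nu$ on $\theta\in\Theta$ and a family of likelihoods $\{f_\theta:\theta\in\Theta\}$ on $\mathcal{X}$, and let $f_{\mathrm{PPD}}(\cdot\mid X)$ be its posterior predictive distribution. Given $X\in\mathcal{X}$, for a finite integer $m\ge1$ let $X_1,\dots,X_m$ be, conditionally on $X$, i.i.d. draws from $f_{\mathrm{PPD}}(\cdot\mid X)$ and let \[p_m=\frac{1+\sum_{i=1}^m \mathbf{1}\{T(X_i)\ge T(X)\}}{m+1};\] for $m=\infty$ let $p_\infty=\mathbb{P}\{T(X')\ge T(X)\mid X\}$, where $X'\mid X\sim f_{\mathrm{PPD}}(\cdot\mid X)$. If $X$ is drawn from the Bayesian model (that is, $\theta\sim\nu$ and $X\mid\theta\sim f_\theta$), then for every finite $m\ge1$ and for $m=\infty$, \[\mathbb{P}\{p_m\le\alpha\}\le2\alpha\quad\text{for all }\alpha\in[0,1].\]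
   Context: The $f_\theta$ are probability densities on $\mathcal{X}$ with respect to a common dominating measure, jointly measurable in $(\theta,x)$. $\nu(\cdot\mid X)$ denotes the posterior distribution of $\theta$ given $X$ in the model $\theta\sim\nu$, $X\mid\theta\sim f_\theta$. The posterior predictive distribution given $X$ has density \[f_{\mathrm{PPD}}(x\mid X)=\mathbb{E}_{\theta\sim\nu(\cdot\mid X)}[f_\theta(x)],\] i.e. sampling from it means first drawing $\theta\sim\nu(\cdot\mid X)$ and then drawing from $f_\theta$. *)

theory Defs
  imports "HOL-Probability.Probability"
begin

text \<open>Only the \<open>\<sigma>\<close>-algebra of the argument matters here; the measure is irrelevant.\<close>

definition standard_borel :: "'a measure \<Rightarrow> bool" where
  "standard_borel M \<longleftrightarrow>
     (\<exists>S. completely_metrizable_space S \<and> separable_space S \<and> topspace S = space M \<and>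
          sets M = sigma_sets (space M) {U. openin S U})"

text \<open>
  \<open>K\<close> is a regular conditional distribution of the \<open>N\<close>-valued random variable \<open>Y\<close> given the
  \<open>M\<close>-valued random variable \<open>X\<close>: a probability kernel from \<open>M\<close> to \<open>N\<close> that disintegrates
  the joint law of \<open>(X, Y)\<close>.
\<close>

definition cond_distr ::
  "'w measure \<Rightarrow> 'a measure \<Rightarrow> ('w \<Rightarrow> 'a) \<Rightarrow> 'b measure \<Rightarrow> ('w \<Rightarrow> 'b) \<Rightarrow> ('a \<Rightarrow> 'b measure) \<Rightarrow> bool"
where
  "cond_distr P M X N Y K \<longleftrightarrow>
     X \<in> measurable P M \<and> Y \<in> measurable P N \<and> K \<in> measurable M (prob_algebra N) \<and>
     (\<forall>A\<in>sets M. \<forall>B\<in>sets N.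
        emeasure P {\<omega> \<in> space P. X \<omega> \<in> A \<and> Y \<omega> \<in> B} =
        (\<integral>\<^sup>+\<omega>. indicator A (X \<omega>) * emeasure (K (X \<omega>)) B \<partial>P))"

text \<open>
  In the next two definitions \<open>\<pi>\<close> is the posterior \<open>\<nu>(\<cdot> | X)\<close> at the observed data. Posteriors are
  treated as conditional distributions of the parameter given the data, in the sense of
  \<^const>\<open>cond_distr\<close>; Bayes' formula (normalising \<open>\<theta> \<mapsto> f \<theta> x\<close> with respect to \<open>\<nu>\<close>) gives one version.
\<close>

definition ppd_density :: "('t \<Rightarrow> 'x \<Rightarrow> ennreal) \<Rightarrow> 't measure \<Rightarrow> 'x \<Rightarrow> ennreal" where
  "ppd_density f \<pi> x = (\<integral>\<^sup>+\<theta>. f \<theta> x \<partial>\<pi>)"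

definition ppd :: "'x measure \<Rightarrow> ('t \<Rightarrow> 'x \<Rightarrow> ennreal) \<Rightarrow> 't measure \<Rightarrow> 'x measure" where
  "ppd \<mu> f \<pi> = density \<mu> (ppd_density f \<pi>)"

definition pval_fin :: "('x \<Rightarrow> real) \<Rightarrow> nat \<Rightarrow> 'x \<Rightarrow> (nat \<Rightarrow> 'x) \<Rightarrow> real" where
  "pval_fin T m x xs = (1 + (\<Sum>i=1..m. of_bool (T (xs i) \<ge> T x))) / (real m + 1)"

text \<open>\<open>D\<close> is the distribution of the new draw given that the observed data equal \<open>x\<close>.\<close>

definition pval_inf :: "('x \<Rightarrow> real) \<Rightarrow> 'x measure \<Rightarrow> 'x \<Rightarrow> real" where
  "pval_inf T D x = measure D {x' \<in> space D. T x' \<ge> T x}"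

end

theory Submission
  imports Defs
begin

text \<open>
  Given \<open>\<theta>\<close>, the tail probability \<open>U = f\<^sub>\<theta>{T \<ge> T X}\<close> is super-uniform, and \<open>p\<^sub>\<infinity>\<close> is the posterior
  mean of \<open>U\<close> given \<open>X\<close>. Jensen's inequality gives \<open>E \<psi>(p\<^sub>\<infinity>) \<le> E \<psi>(U) \<le> \<integral>\<^sub>0\<^sup>1 \<psi>\<close> for every decreasing convex
  \<open>\<psi>\<close>. With \<open>\<psi>(u) = max 0 (2\<alpha> - u)\<close> the right-hand side is at most \<open>2\<alpha>\<^sup>2\<close>, while \<open>\<psi> \<ge> \<alpha>\<close> on \<open>{p\<^sub>\<infinity> \<le> \<alpha>}\<close>.

  For finite \<open>m\<close>, the number of \<open>X\<^sub>i\<close> in the tail is binomial with success probability \<open>p\<^sub>\<infinity>\<close> given \<open>X\<close>. So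
  \<open>E max 0 (2\<alpha> - p\<^sub>m) = E \<psi>(p\<^sub>\<infinity>)\<close>, where \<open>\<psi>\<close> is the Bernstein polynomial of
  \<open>\<phi> k = max 0 (2\<alpha> - (1 + k) / (m + 1))\<close>. It inherits monotonicity and convexity from \<open>\<phi>\<close>, and
  \<open>\<integral>\<^sub>0\<^sup>1 \<psi>\<close> is the average of \<open>\<phi>\<close> over \<open>{0..m}\<close>, which is again at most \<open>2\<alpha>\<^sup>2\<close>.
\<close>

section \<open>Disintegration\<close>

text \<open>\<open>cond_distr\<close> speaks only of rectangles. They form an intersection-stable
  generator of the product sigma-algebra, so the law of \<open>(X, Y)\<close> equals the mixture
  built from \<open>K\<close>, and integrals of nonnegative functions agree.\<close>

lemma cond_distr_nn_integral:
  assumes P: "prob_space P" and K: "cond_distr P M X N Y K"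
    and h[measurable]: "h \<in> borel_measurable (M \<Otimes>\<^sub>M N)"
  shows "(\<integral>\<^sup>+\<omega>. h (X \<omega>, Y \<omega>) \<partial>P) = (\<integral>\<^sup>+\<omega>. (\<integral>\<^sup>+y. h (X \<omega>, y) \<partial>K (X \<omega>)) \<partial>P)"
proof -
  interpret P: prob_space P by (rule P)
  have [measurable]: "X \<in> measurable P M" "Y \<in> measurable P N"
    and Kp: "K \<in> measurable M (prob_algebra N)"
    and eq: "\<And>A B. A \<in> sets M \<Longrightarrow> B \<in> sets N \<Longrightarrow>
        emeasure P {\<omega> \<in> space P. X \<omega> \<in> A \<and> Y \<omega> \<in> B} =
        (\<integral>\<^sup>+\<omega>. indicator A (X \<omega>) * emeasure (K (X \<omega>)) B \<partial>P)"
    using K by (auto simp: cond_distr_def)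
  note [measurable] = measurable_prob_algebraD[OF Kp]
  \<comment> \<open>\<open>k \<omega>\<close> is the law of \<open>(X \<omega>, y)\<close> with
    \<open>y\<close> drawn from \<open>K (X \<omega>)\<close>; mixing it over \<open>P\<close> gives
    the joint law that \<open>K\<close> prescribes.\<close>
  define k where "k \<omega> = K (X \<omega>) \<bind> (\<lambda>y. return (M \<Otimes>\<^sub>M N) (X \<omega>, y))" for \<omega>
  have k[measurable]: "k \<in> measurable P (subprob_algebra (M \<Otimes>\<^sub>M N))"
    unfolding k_def by (rule measurable_bind[where N = N]) measurable
  have ret: "(\<lambda>y. return (M \<Otimes>\<^sub>M N) (X \<omega>, y)) \<in> measurable N (subprob_algebra (M \<Otimes>\<^sub>M N))"
    if "\<omega> \<in> space P" for \<omega>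
  proof -
    have "X \<omega> \<in> space M" using that by (rule measurable_space[rotated]) measurable
    then show ?thesis by measurable
  qed
  have KX: "K (X \<omega>) \<in> space (prob_algebra N)" if "\<omega> \<in> space P" for \<omega>
    using that by (meson K Kp cond_distr_def measurable_space)
  have kint: "(\<integral>\<^sup>+z. g z \<partial>k \<omega>) = (\<integral>\<^sup>+y. g (X \<omega>, y) \<partial>K (X \<omega>))"
    if w: "\<omega> \<in> space P" and g[measurable]: "g \<in> borel_measurable (M \<Otimes>\<^sub>M N)" for \<omega> g
  proof -
    have Ks: "sets (K (X \<omega>)) = sets N" using KX[OF w] by (simp add: space_prob_algebra)
    have X: "X \<omega> \<in> space M" using w by (rule measurable_space[rotated]) measurable
    have "(\<integral>\<^sup>+z. g z \<partial>k \<omega>) = (\<integral>\<^sup>+y. \<integral>\<^sup>+z. g z \<partial>return (M \<Otimes>\<^sub>M N) (X \<omega>, y) \<partial>K (X \<omega>))"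
      unfolding k_def
      by (rule nn_integral_bind[OF g]) (use ret[OF w] Ks in \<open>simp cong: measurable_cong_sets\<close>)
    also have "\<dots> = (\<integral>\<^sup>+y. g (X \<omega>, y) \<partial>K (X \<omega>))"
      using X sets_eq_imp_space_eq[OF Ks]
      by (intro nn_integral_cong nn_integral_return g) (auto simp: space_pair_measure)
    finally show ?thesis .
  qed
  let ?L = "distr P (M \<Otimes>\<^sub>M N) (\<lambda>\<omega>. (X \<omega>, Y \<omega>))"
  let ?R = "P \<bind> k"
  have setsR: "sets ?R = sets (M \<Otimes>\<^sub>M N)"
    by (rule sets_bind) (simp_all add: sets_kernel[OF k] P.not_empty)
  have "?L = ?R"
  proof (rule measure_eqI_generator_eq[OF Int_stable_pair_measure_generator[of M N],
        where \<Omega> = "space M \<times> space N" and A = "\<lambda>_. space M \<times> space N"])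
    show "{a \<times> b |a b. a \<in> sets M \<and> b \<in> sets N} \<subseteq> Pow (space M \<times> space N)"
      using sets.space_closed[of M] sets.space_closed[of N] by auto
    show "sets ?L = sigma_sets (space M \<times> space N) {a \<times> b |a b. a \<in> sets M \<and> b \<in> sets N}"
      "sets ?R = sigma_sets (space M \<times> space N) {a \<times> b |a b. a \<in> sets M \<and> b \<in> sets N}"
      by (simp_all add: setsR sets_pair_measure)
    show "emeasure ?L (space M \<times> space N) \<noteq> \<infinity>" for i :: nat
      by (simp add: emeasure_distr space_pair_measure[symmetric])
    fix Z assume "Z \<in> {a \<times> b |a b. a \<in> sets M \<and> b \<in> sets N}"
    then obtain A B where Z: "Z = A \<times> B" and [measurable]: "A \<in> sets M" "B \<in> sets N" by auto
    have "emeasure ?L Z = emeasure P {\<omega> \<in> space P. X \<omega> \<in> A \<and> Y \<omega> \<in> B}"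
      unfolding Z by (subst emeasure_distr) (auto intro!: arg_cong[where f = "emeasure P"])
    also have "\<dots> = (\<integral>\<^sup>+\<omega>. indicator A (X \<omega>) * emeasure (K (X \<omega>)) B \<partial>P)"
      by (rule eq) fact+
    also have "\<dots> = (\<integral>\<^sup>+\<omega>. (\<integral>\<^sup>+z. indicator Z z \<partial>k \<omega>) \<partial>P)"
    proof (rule nn_integral_cong)
      fix \<omega> assume w: "\<omega> \<in> space P"
      have "sets (K (X \<omega>)) = sets N" using KX[OF w] by (simp add: space_prob_algebra)
      then have "indicator A (X \<omega>) * emeasure (K (X \<omega>)) B
          = (\<integral>\<^sup>+y. indicator A (X \<omega>) * indicator B y \<partial>K (X \<omega>))"
        by (subst nn_integral_cmult_indicator) auto
      also have "\<dots> = (\<integral>\<^sup>+y. indicator Z (X \<omega>, y) \<partial>K (X \<omega>))"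
        by (simp add: Z indicator_times)
      finally show "indicator A (X \<omega>) * emeasure (K (X \<omega>)) B = (\<integral>\<^sup>+z. indicator Z z \<partial>k \<omega>)"
        using kint[OF w, of "indicator Z"] by (simp add: Z)
    qed
    also have "\<dots> = (\<integral>\<^sup>+z. indicator Z z \<partial>?R)"
      by (rule nn_integral_bind[symmetric, OF _ k]) (simp add: Z)
    also have "\<dots> = emeasure ?R Z"
      by (rule nn_integral_indicator) (simp add: Z setsR)
    finally show "emeasure ?L Z = emeasure ?R Z" .
  qed auto
  then have "(\<integral>\<^sup>+z. h z \<partial>?L) = (\<integral>\<^sup>+z. h z \<partial>?R)" by simp
  then show ?thesis
    by (simp add: nn_integral_distr nn_integral_bind[OF h k] kint cong: nn_integral_cong)
qed

section \<open>Super-uniform random variables\<close>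

text \<open>Tonelli, after writing \<open>ennreal (f x)\<close> as the length of
  \<open>{0..<f x}\<close>; negative values of \<open>f\<close> count as 0 on both sides.\<close>

lemma nn_integral_layer_cake:
  assumes "sigma_finite_measure M" and f[measurable]: "f \<in> borel_measurable M"
  shows "(\<integral>\<^sup>+x. ennreal (f x) \<partial>M)
    = (\<integral>\<^sup>+t. indicator {0..} t * emeasure M {x \<in> space M. t < f x} \<partial>lborel)"
proof -
  interpret sigma_finite_measure M by fact
  interpret pair_sigma_finite lborel M ..
  have "ennreal (f x) = (\<integral>\<^sup>+t. indicator {0..} t * indicator {t. t < f x} t \<partial>lborel)" for x
  proof -
    have "ennreal (f x) = emeasure lborel {0..<f x}" by (cases "0 \<le> f x") (simp_all add: ennreal_neg)
    also have "\<dots> = (\<integral>\<^sup>+t. indicator {0..<f x} t \<partial>lborel)" by simp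
    also have "\<dots> = (\<integral>\<^sup>+t. indicator {0..} t * indicator {t. t < f x} t \<partial>lborel)"
      by (intro nn_integral_cong) (auto split: split_indicator)
    finally show ?thesis .
  qed
  then have "(\<integral>\<^sup>+x. ennreal (f x) \<partial>M)
    = (\<integral>\<^sup>+x. \<integral>\<^sup>+t. indicator {0..} t * indicator {t. t < f x} t \<partial>lborel \<partial>M)" by simp
  also have "\<dots> = (\<integral>\<^sup>+t. \<integral>\<^sup>+x. indicator {0..} t * indicator {t. t < f x} t \<partial>M \<partial>lborel)"
    by (rule Fubini') measurable
  also have "\<dots> = (\<integral>\<^sup>+t. indicator {0..} t * emeasure M {x \<in> space M. t < f x} \<partial>lborel)"
  proof (rule nn_integral_cong)
    fix t :: real
    have "(\<integral>\<^sup>+x. indicator {0..} t * indicator {t. t < f x} t \<partial>M)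
      = (\<integral>\<^sup>+x. indicator {0..} t * indicator {x \<in> space M. t < f x} x \<partial>M)"
      by (intro nn_integral_cong) (auto split: split_indicator)
    also have "\<dots> = indicator {0..} t * emeasure M {x \<in> space M. t < f x}"
      by (rule nn_integral_cmult_indicator) measurable
    finally show "(\<integral>\<^sup>+x. indicator {0..} t * indicator {t. t < f x} t \<partial>M)
      = indicator {0..} t * emeasure M {x \<in> space M. t < f x}" .
  qed
  finally show ?thesis .
qed

text \<open>Inner regularity on the line. It serves for intervals and rays whose endpoint may or may
  not belong to them: a nonempty compact subset attains its extremum inside the set, where the
  defining inequality can be used.\<close>

lemma emeasure_le_of_compact_subsets:
  fixes M :: "real measure"
  assumes "finite_measure M" "sets M = sets borel" "A \<in> sets borel"
    and "\<And>K. compact K \<Longrightarrow> K \<noteq> {} \<Longrightarrow> K \<subseteq> A \<Longrightarrow> emeasure M K \<le> c"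
  shows "emeasure M A \<le> c"
proof -
  have "emeasure M (space M) \<noteq> \<infinity>"
    using finite_measure.emeasure_finite[OF assms(1)] by auto
  then have "emeasure M A = (SUP K \<in> {K. K \<subseteq> A \<and> compact K}. emeasure M K)"
    using assms by (intro inner_regular) auto
  also have "\<dots> \<le> c"
  proof (rule SUP_least)
    fix K assume "K \<in> {K. K \<subseteq> A \<and> compact K}"
    then show "emeasure M K \<le> c" using assms(4)[of K] by (cases "K = {}") auto
  qed
  finally show ?thesis .
qed

text \<open>Superlevel sets of a decreasing \<open>\<psi>\<close> are initial segments of
  \<open>{0..1}\<close>, and \<open>V\<close> gives each of them at most its length; the layer cake
  formula integrates this comparison over all levels.\<close>

lemma superuniform_antimono_integral_le:
  fixes V :: "'a \<Rightarrow> real" and \<psi> :: "real \<Rightarrow> real"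
  assumes M: "prob_space M" and V[measurable]: "V \<in> borel_measurable M"
    and V01: "\<And>x. x \<in> space M \<Longrightarrow> V x \<in> {0..1}"
    and sup: "\<And>u. u \<in> {0..1} \<Longrightarrow> emeasure M {x \<in> space M. V x \<le> u} \<le> ennreal u"
    and \<psi>[measurable]: "\<psi> \<in> borel_measurable borel" and anti: "antimono_on {0..1} \<psi>"
  shows "(\<integral>\<^sup>+x. ennreal (\<psi> (V x)) \<partial>M) \<le> (\<integral>\<^sup>+u. ennreal (\<psi> u) * indicator {0..1} u \<partial>lborel)"
proof -
  interpret M: prob_space M by (rule M)
  let ?U = "restrict_space lborel {0..1::real}"
  have U: "sigma_finite_measure ?U" by (rule sigma_finite_measure_restrict_space) (auto intro: sigma_finite_lborel)
  have le: "emeasure M {x \<in> space M. t < \<psi> (V x)} \<le> emeasure ?U {u \<in> space ?U. t < \<psi> u}" for t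
  proof -
    let ?A = "{u \<in> {0..1}. t < \<psi> u}"
    have A: "?A \<in> sets borel" by measurable
    have "emeasure M {x \<in> space M. t < \<psi> (V x)} = emeasure (distr M borel V) ?A"
      using V01 A by (subst emeasure_distr) (auto intro!: arg_cong[where f = "emeasure M"])
    also have "\<dots> \<le> emeasure lborel ?A"
    proof (rule emeasure_le_of_compact_subsets[OF _ _ A])
      show "finite_measure (distr M borel V)"
        by (intro prob_space.finite_measure M.prob_space_distr) measurable
      fix K assume K: "compact K" "K \<noteq> {}" "K \<subseteq> ?A"
      \<comment> \<open>The maximum \<open>k\<close> satisfies \<open>t < \<psi> k\<close>, so
        \<open>{0..k}\<close> lies in the superlevel set, while super-uniformity bounds the mass of
        \<open>K\<close> by the length \<open>k\<close>.\<close>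
      obtain k where k: "k \<in> K" "\<And>y. y \<in> K \<Longrightarrow> y \<le> k"
        using compact_attains_sup[OF K(1,2)] by auto
      have k01: "k \<in> {0..1}" "t < \<psi> k" using k K by auto
      have "emeasure (distr M borel V) K \<le> emeasure (distr M borel V) {..k}"
        by (rule emeasure_mono) (use k in auto)
      also have "\<dots> = emeasure M {x \<in> space M. V x \<le> k}"
        by (subst emeasure_distr) (auto intro!: arg_cong[where f = "emeasure M"])
      also have "\<dots> \<le> ennreal k" by (rule sup) fact
      also have "\<dots> = emeasure lborel {0..k}" using k01 by simp
      also have "\<dots> \<le> emeasure lborel ?A"
      proof (rule emeasure_mono)
        show "{0..k} \<subseteq> ?A"
        proof
          fix y assume y: "y \<in> {0..k}"
          have "\<psi> k \<le> \<psi> y"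
            using anti k01 y by (auto simp: monotone_on_def)
          then show "y \<in> ?A" using y k01 by auto
        qed
      qed (use A in simp)
      finally show "emeasure (distr M borel V) K \<le> emeasure lborel ?A" .
    qed simp
    also have "\<dots> = emeasure ?U {u \<in> space ?U. t < \<psi> u}"
      by (subst emeasure_restrict_space) (auto simp: space_restrict_space)
    finally show ?thesis .
  qed
  have "(\<integral>\<^sup>+x. ennreal (\<psi> (V x)) \<partial>M)
      = (\<integral>\<^sup>+t. indicator {0..} t * emeasure M {x \<in> space M. t < \<psi> (V x)} \<partial>lborel)"
    by (rule nn_integral_layer_cake[OF M.sigma_finite_measure_axioms]) measurable
  also have "\<dots> \<le> (\<integral>\<^sup>+t. indicator {0..} t * emeasure ?U {u \<in> space ?U. t < \<psi> u} \<partial>lborel)"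
    by (intro nn_integral_mono mult_left_mono le) simp
  also have "\<dots> = (\<integral>\<^sup>+u. ennreal (\<psi> u) \<partial>?U)"
    by (rule nn_integral_layer_cake[OF U, symmetric]) (simp add: measurable_restrict_space1)
  also have "\<dots> = (\<integral>\<^sup>+u. ennreal (\<psi> u) * indicator {0..1} u \<partial>lborel)"
    by (simp add: nn_integral_restrict_space)
  finally show ?thesis .
qed

text \<open>The survival function \<open>S\<close> decreases, so \<open>{t. S t \<le> u}\<close> is
  closed upwards. A compact subset with minimum \<open>k\<close> lies in \<open>{k..}\<close>, whose
  mass is exactly \<open>S k\<close>; atoms are covered because the tail includes ties.\<close>

lemma superuniform_tail_probability:
  fixes T :: "'a \<Rightarrow> real"
  assumes D: "prob_space D" and T[measurable]: "T \<in> borel_measurable D"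
  shows "emeasure D {x \<in> space D. measure D {x' \<in> space D. T x \<le> T x'} \<le> u} \<le> ennreal u"
proof -
  interpret D: prob_space D by (rule D)
  define S where "S t = measure D {x' \<in> space D. t \<le> T x'}" for t
  have "antimono S"
    unfolding S_def by (rule antimonoI, rule D.finite_measure_mono) auto
  then have "mono (\<lambda>t. - S t)" by (auto simp: monotone_def)
  then have "(\<lambda>t. - (- S t)) \<in> borel_measurable borel"
    by (intro borel_measurable_uminus borel_measurable_mono)
  then have [measurable]: "S \<in> borel_measurable borel" by simp
  let ?A = "{t. S t \<le> u}"
  have "emeasure D {x \<in> space D. S (T x) \<le> u} = emeasure (distr D borel T) ?A"
    by (subst emeasure_distr) (auto intro!: arg_cong[where f = "emeasure D"])
  also have "\<dots> \<le> ennreal u"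
  proof (rule emeasure_le_of_compact_subsets)
    show "finite_measure (distr D borel T)"
      by (intro prob_space.finite_measure D.prob_space_distr) measurable
    fix K assume K: "compact K" "K \<noteq> {}" "K \<subseteq> ?A"
    obtain k where k: "k \<in> K" "\<And>y. y \<in> K \<Longrightarrow> k \<le> y"
      using compact_attains_inf[OF K(1,2)] by auto
    have "emeasure (distr D borel T) K \<le> emeasure (distr D borel T) {k..}"
      by (rule emeasure_mono) (use k in auto)
    also have "\<dots> = ennreal (S k)"
      unfolding S_def D.emeasure_eq_measure[symmetric]
      by (subst emeasure_distr) (auto intro!: arg_cong[where f = "emeasure D"])
    also have "\<dots> \<le> ennreal u" using k(1) K(3) by (intro ennreal_leI) auto
    finally show "emeasure (distr D borel T) K \<le> ennreal u" .
  qed simp_all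
  finally show ?thesis unfolding S_def .
qed

section \<open>Binomial means\<close>

text \<open>
  For \<open>p \<in> {0..1}\<close> this is the mean of \<open>\<phi>\<close> under the binomial distribution with parameters \<open>m\<close> and
  \<open>p\<close>; the recursion conditions on the first trial. It is a polynomial in \<open>p\<close> on all of \<open>\<real>\<close>.
\<close>

primrec binom_mean :: "nat \<Rightarrow> (nat \<Rightarrow> real) \<Rightarrow> real \<Rightarrow> real" where
  "binom_mean 0 \<phi> p = \<phi> 0"
| "binom_mean (Suc m) \<phi> p = (1 - p) * binom_mean m \<phi> p + p * binom_mean m (\<lambda>k. \<phi> (Suc k)) p"

text \<open>Linearity in the weights: the difference of the two branches of the recursion becomes a
  mean of forward differences.\<close>

lemma binom_mean_diff:
  "binom_mean m (\<lambda>k. \<phi> k - \<eta> k) p = binom_mean m \<phi> p - binom_mean m \<eta> p"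
proof (induction m arbitrary: \<phi> \<eta>)
  case (Suc m)
  show ?case by (simp only: binom_mean.simps Suc) (simp add: algebra_simps)
qed simp

lemma binom_mean_nonneg:
  "(\<And>k. 0 \<le> \<phi> k) \<Longrightarrow> p \<in> {0..1} \<Longrightarrow> 0 \<le> binom_mean m \<phi> p"
  by (induction m arbitrary: \<phi>) auto

lemma binom_mean_nonpos:
  "(\<And>k. \<phi> k \<le> 0) \<Longrightarrow> p \<in> {0..1} \<Longrightarrow> binom_mean m \<phi> p \<le> 0"
  \<comment> \<open>The last instance, with both weights zero, says that the mean of 0 is 0; the
    middle one then moves the sign of \<open>\<phi>\<close> outside.\<close>
  using binom_mean_nonneg[of "\<lambda>k. - \<phi> k" p m] binom_mean_diff[of m "\<lambda>k. 0" \<phi> p]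
    binom_mean_diff[of m "\<lambda>k. 0" "\<lambda>k. 0" p] by simp

lemma binom_mean_0: "binom_mean m \<phi> 0 = \<phi> 0"
  by (induction m arbitrary: \<phi>) auto

lemma binom_mean_1: "binom_mean m \<phi> 1 = \<phi> m"
  by (induction m arbitrary: \<phi>) auto

lemma borel_measurable_binom_mean[measurable]: "binom_mean m \<phi> \<in> borel_measurable borel"
proof (induction m arbitrary: \<phi>)
  case 0
  have "(\<lambda>p. binom_mean 0 \<phi> p) \<in> borel_measurable borel" by simp
  then show ?case by simp
next
  case (Suc m)
  note Suc[measurable]
  have "(\<lambda>p. binom_mean (Suc m) \<phi> p) \<in> borel_measurable borel" by simp
  then show ?case by simp
qed

text \<open>The derivative rule for Bernstein polynomials. The product rule yields the difference of
  the two branches plus \<open>m\<close> times a one-trial expansion of the same mean of forward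
  differences.\<close>

lemma DERIV_binom_mean:
  "(binom_mean m \<phi> has_real_derivative
     real m * binom_mean (m - 1) (\<lambda>k. \<phi> (Suc k) - \<phi> k) p) (at p)"
proof (induction m arbitrary: \<phi>)
  case 0
  show ?case by simp
next
  case (Suc m)
  have "((\<lambda>p. binom_mean (Suc m) \<phi> p) has_real_derivative
      binom_mean m (\<lambda>k. \<phi> (Suc k) - \<phi> k) p
      + real m * ((1 - p) * binom_mean (m - 1) (\<lambda>k. \<phi> (Suc k) - \<phi> k) p
        + p * binom_mean (m - 1) (\<lambda>k. \<phi> (Suc (Suc k)) - \<phi> (Suc k)) p)) (at p)"
    by (auto intro!: derivative_eq_intros Suc simp: binom_mean_diff algebra_simps)
  \<comment> \<open>For \<open>m = 0\<close> the factor \<open>real m\<close> removes the truncated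
    index \<open>m - 1\<close>; otherwise the bracket is the recursion for
    \<open>binom_mean m\<close>.\<close>
  then show ?case by (cases m) (simp_all add: algebra_simps)
qed

text \<open>The derivative is a nonnegative multiple of a mean of forward differences, all
  nonpositive.\<close>

lemma binom_mean_antimono:
  assumes "\<And>k. \<phi> (Suc k) \<le> \<phi> k"
  shows "antimono_on {0..1} (binom_mean m \<phi>)"
proof (rule monotone_onI)
  fix x y :: real assume xy: "x \<in> {0..1}" "y \<in> {0..1}" "x \<le> y"
  show "binom_mean m \<phi> y \<le> binom_mean m \<phi> x"
  proof (rule DERIV_nonpos_imp_nonincreasing[OF xy(3)])
    fix z assume z: "x \<le> z" "z \<le> y"
    have "binom_mean (m - 1) (\<lambda>k. \<phi> (Suc k) - \<phi> k) z \<le> 0"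
      by (rule binom_mean_nonpos) (use assms z xy in auto)
    then show "\<exists>d. (binom_mean m \<phi> has_real_derivative d) (at z) \<and> d \<le> 0"
      using DERIV_binom_mean by (meson mult_nonneg_nonpos of_nat_0_le_iff)
  qed
qed

text \<open>Differentiating twice gives a mean of second differences, hence convexity. It is
  recorded as a tangent inequality because the Jensen argument consumes supporting lines.\<close>

lemma binom_mean_above_tangent:
  assumes convex: "\<And>k. 2 * \<phi> (Suc k) \<le> \<phi> k + \<phi> (Suc (Suc k))"
    and p: "p \<in> {0..1}" and q: "q \<in> {0..1}"
  shows "binom_mean m \<phi> p + real m * binom_mean (m - 1) (\<lambda>k. \<phi> (Suc k) - \<phi> k) p * (q - p)
    \<le> binom_mean m \<phi> q"
proof -
  let ?d = "\<lambda>k. \<phi> (Suc k) - \<phi> k"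
  have "real m * binom_mean (m - 1) ?d p * (q - p) \<le> binom_mean m \<phi> q - binom_mean m \<phi> p"
  proof (rule f''_imp_f'[of "{0..1}" "binom_mean m \<phi>" "\<lambda>p. real m * binom_mean (m - 1) ?d p",
        OF _ _ _ _ p q])
    fix x :: real assume x: "x \<in> {0..1}"
    show "((\<lambda>p. real m * binom_mean (m - 1) ?d p) has_real_derivative
        real m * (real (m - 1) * binom_mean (m - 1 - 1) (\<lambda>k. ?d (Suc k) - ?d k) x)) (at x)"
      by (intro DERIV_cmult DERIV_binom_mean)
    have "0 \<le> binom_mean (m - 1 - 1) (\<lambda>k. ?d (Suc k) - ?d k) x"
    proof (rule binom_mean_nonneg[OF _ x])
      show "0 \<le> ?d (Suc k) - ?d k" for k using convex[of k] by simp
    qed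
    then show "0 \<le> real m * (real (m - 1) * binom_mean (m - 1 - 1) (\<lambda>k. ?d (Suc k) - ?d k) x)"
      by simp
  qed (simp_all add: DERIV_binom_mean[unfolded One_nat_def])
  then show ?thesis by simp
qed

text \<open>The antiderivative is again a binomial mean, of the partial sums of \<open>\<phi>\<close>.\<close>

lemma nn_integral_binom_mean:
  assumes "\<And>k. 0 \<le> \<phi> k"
  shows "(\<integral>\<^sup>+u. ennreal (binom_mean m \<phi> u) * indicator {0..1} u \<partial>lborel)
    = ennreal ((\<Sum>k\<le>m. \<phi> k) / real (Suc m))"
proof -
  let ?F = "\<lambda>u. binom_mean (Suc m) (\<lambda>k. sum \<phi> {..<k}) u / real (Suc m)"
  have "(\<integral>\<^sup>+u. ennreal (binom_mean m \<phi> u) * indicator {0..1} u \<partial>lborel) = ennreal (?F 1 - ?F 0)"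
  proof (rule nn_integral_FTC_Icc)
    fix u :: real assume u: "u \<in> {0..1}"
    show "(?F has_real_derivative binom_mean m \<phi> u) (at u)"
      using DERIV_cdivide[OF DERIV_binom_mean[of "Suc m" "\<lambda>k. sum \<phi> {..<k}" u], of "real (Suc m)"]
      by (simp del: binom_mean.simps of_nat_Suc)
    show "0 \<le> binom_mean m \<phi> u" using assms u by (auto intro: binom_mean_nonneg)
  qed simp_all
  then show ?thesis
    by (simp add: binom_mean_0 binom_mean_1 lessThan_Suc_atMost del: binom_mean.simps of_nat_Suc)
qed

text \<open>Integrating out the newly inserted coordinate conditions on one trial: a miss keeps
  \<open>\<phi>\<close>, a hit shifts it by \<open>Suc\<close>, exactly as in the recursion of
  \<open>binom_mean\<close>. Hence the induction generalises over \<open>\<phi>\<close>.\<close>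

lemma nn_integral_PiM_count:
  assumes D: "prob_space D" and A[measurable]: "A \<in> sets D" and I: "finite I"
    and "\<And>k. 0 \<le> \<phi> k"
  shows "(\<integral>\<^sup>+x. ennreal (\<phi> (\<Sum>i\<in>I. of_bool (x i \<in> A))) \<partial>(\<Pi>\<^sub>M i\<in>I. D))
    = ennreal (binom_mean (card I) \<phi> (measure D A))"
  using I assms(4)
proof (induction I arbitrary: \<phi>)
  case empty
  show ?case by (simp add: PiM_empty nn_integral_count_space_finite)
next
  case (insert i I)
  interpret D: prob_space D by (rule D)
  interpret product_sigma_finite "\<lambda>_. D" by standard
  let ?p = "measure D A" and ?s = "\<lambda>x. \<Sum>j\<in>I. of_bool (x j \<in> A) :: nat"
  have p: "0 \<le> ?p" "?p \<le> 1" by simp_all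
  have "(\<integral>\<^sup>+x. ennreal (\<phi> (\<Sum>j\<in>insert i I. of_bool (x j \<in> A))) \<partial>(\<Pi>\<^sub>M i\<in>insert i I. D))
     = (\<integral>\<^sup>+x. \<integral>\<^sup>+y. ennreal (\<phi> (\<Sum>j\<in>insert i I. of_bool ((x(i := y)) j \<in> A))) \<partial>D \<partial>(\<Pi>\<^sub>M i\<in>I. D))"
    by (rule product_nn_integral_insert[OF insert(1,2)]) measurable
  also have "\<dots> = (\<integral>\<^sup>+x. ennreal (1 - ?p) * ennreal (\<phi> (?s x)) + ennreal ?p * ennreal (\<phi> (Suc (?s x)))
      \<partial>(\<Pi>\<^sub>M i\<in>I. D))"
  proof (rule nn_integral_cong)
    fix x assume "x \<in> space (\<Pi>\<^sub>M i\<in>I. D)"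
    have "(\<Sum>j\<in>insert i I. of_bool ((x(i := y)) j \<in> A)) = of_bool (y \<in> A) + ?s x" for y
    proof -
      have "(\<Sum>j\<in>I. of_bool ((x(i := y)) j \<in> A)) = ?s x"
        using insert(2) by (intro sum.cong) auto
      then show ?thesis
        unfolding sum.insert[OF insert(1,2)] by (simp del: sum_of_bool_eq)
    qed
    then have "(\<integral>\<^sup>+y. ennreal (\<phi> (\<Sum>j\<in>insert i I. of_bool ((x(i := y)) j \<in> A))) \<partial>D)
      = (\<integral>\<^sup>+y. ennreal (\<phi> (?s x)) * indicator (space D - A) y
          + ennreal (\<phi> (Suc (?s x))) * indicator A y \<partial>D)"
      by (intro nn_integral_cong) (auto split: split_indicator)
    also have "\<dots> = ennreal (\<phi> (?s x)) * emeasure D (space D - A) + ennreal (\<phi> (Suc (?s x))) * emeasure D A"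
      by (subst nn_integral_add) (simp_all add: nn_integral_cmult_indicator)
    also have "emeasure D (space D - A) = ennreal (1 - ?p)"
      by (simp add: D.emeasure_eq_measure D.prob_compl)
    finally show "(\<integral>\<^sup>+y. ennreal (\<phi> (\<Sum>j\<in>insert i I. of_bool ((x(i := y)) j \<in> A))) \<partial>D)
      = ennreal (1 - ?p) * ennreal (\<phi> (?s x)) + ennreal ?p * ennreal (\<phi> (Suc (?s x)))"
      by (simp add: D.emeasure_eq_measure mult.commute)
  qed
  also have "\<dots> = ennreal (1 - ?p) * (\<integral>\<^sup>+x. ennreal (\<phi> (?s x)) \<partial>(\<Pi>\<^sub>M i\<in>I. D))
      + ennreal ?p * (\<integral>\<^sup>+x. ennreal (\<phi> (Suc (?s x))) \<partial>(\<Pi>\<^sub>M i\<in>I. D))"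
    by (subst nn_integral_add) (simp_all add: nn_integral_cmult)
  also have "\<dots> = ennreal (binom_mean (card (insert i I)) \<phi> ?p)"
    using insert p insert.IH[of \<phi>] insert.IH[of "\<lambda>k. \<phi> (Suc k)"]
    by (simp add: binom_mean_nonneg ennreal_mult ennreal_plus del: sum_of_bool_eq)
  finally show ?case .
qed

section \<open>From convex moments to tail bounds\<close>

text \<open>Markov's inequality for the hinge, which is at least \<open>a\<close> where
  \<open>Q \<le> a\<close>. A hinge vanishing from \<open>c * a\<close> on, with moment bound
  \<open>(c * a)^2 / 2\<close>, would give the factor \<open>c^2 / (2 * (c - 1))\<close>, which is
  smallest at \<open>c = 2\<close>.\<close>

lemma (in prob_space) prob_le_twice_if_moment_bound:
  assumes "\<And>a. 0 < a \<Longrightarrow> (\<integral>\<^sup>+\<omega>. ennreal (max 0 (2 * a - Q \<omega>)) \<partial>M) \<le> ennreal (2 * a\<^sup>2)"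
    and "0 \<le> \<alpha>"
  shows "prob {\<omega> \<in> space M. Q \<omega> \<le> \<alpha>} \<le> 2 * \<alpha>"
proof (cases "{\<omega> \<in> space M. Q \<omega> \<le> \<alpha>} \<in> sets M")
  case True
  let ?E = "{\<omega> \<in> space M. Q \<omega> \<le> \<alpha>}"
  \<comment> \<open>Taking \<open>a\<close> strictly above \<open>\<alpha>\<close> keeps the
    division by \<open>a\<close> legal when \<open>\<alpha> = 0\<close>; then \<open>a\<close>
    decreases to \<open>\<alpha>\<close>.\<close>
  have "prob ?E / 2 \<le> a" if a: "\<alpha> < a" for a
  proof -
    have a0: "0 < a" using assms(2) a by simp
    have "ennreal (a * prob ?E) = (\<integral>\<^sup>+\<omega>. ennreal a * indicator ?E \<omega> \<partial>M)"
      using a0 True by (simp add: nn_integral_cmult_indicator emeasure_eq_measure ennreal_mult)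
    also have "\<dots> \<le> (\<integral>\<^sup>+\<omega>. ennreal (max 0 (2 * a - Q \<omega>)) \<partial>M)"
      using a by (intro nn_integral_mono) (auto split: split_indicator intro!: ennreal_leI)
    also have "\<dots> \<le> ennreal (2 * a\<^sup>2)" by (rule assms(1)[OF a0])
    finally have "a * prob ?E \<le> a * (2 * a)"
      by (simp add: power2_eq_square mult.left_commute)
    then show ?thesis using a0 by simp
  qed
  then have "prob ?E / 2 \<le> \<alpha>" by (rule dense_ge)
  then show ?thesis by simp
\<comment> \<open>A nonmeasurable event has the default measure 0.\<close>
qed (use assms(2) in \<open>simp add: measure_notin_sets\<close>)

text \<open>The region under the hinge lies in a right triangle with both legs
  \<open>2 * a\<close>.\<close>

lemma nn_integral_hinge_le:
  assumes "0 < a"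
  shows "(\<integral>\<^sup>+u. ennreal (max 0 (2 * a - u)) * indicator {0..1} u \<partial>lborel) \<le> ennreal (2 * a\<^sup>2)"
proof -
  let ?F = "\<lambda>u::real. 2 * a * u - u\<^sup>2 / 2"
  have "(\<integral>\<^sup>+u. ennreal (max 0 (2 * a - u)) * indicator {0..1} u \<partial>lborel)
      \<le> (\<integral>\<^sup>+u. ennreal (2 * a - u) * indicator {0..2 * a} u \<partial>lborel)"
    by (intro nn_integral_mono) (auto split: split_indicator simp: max_def)
  also have "\<dots> = ennreal (?F (2 * a) - ?F 0)"
    by (rule nn_integral_FTC_Icc) (use assms in \<open>auto intro!: derivative_eq_intros\<close>)
  also have "?F (2 * a) - ?F 0 = 2 * a\<^sup>2" by (simp add: power2_eq_square)
  finally show ?thesis .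
qed

text \<open>Each summand is a right-endpoint value, so it is at most the integral of the decreasing
  hinge over \<open>{k..k+1}\<close>; these integrals telescope as half differences of squares. The
  subtracted square makes the induction go through.\<close>

lemma sum_hinge_le:
  fixes b :: real
  assumes "0 \<le> b"
  shows "(\<Sum>k<n. max 0 (b - (1 + real k))) \<le> (b\<^sup>2 - (max 0 (b - real n))\<^sup>2) / 2"
proof (induction n)
  case (Suc n)
  have "max 0 (b - (1 + real n)) \<le> ((max 0 (b - real n))\<^sup>2 - (max 0 (b - real (Suc n)))\<^sup>2) / 2"
    \<comment> \<open>The square is used when \<open>b\<close> lies between \<open>n\<close> and
      \<open>n + 1\<close>: the left side is 0 and the right side is half that square.\<close>
    using zero_le_power2[of "b - real n"] by (auto simp: max_def power2_eq_square field_simps)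
  then show ?case using Suc by (simp add: field_simps)
qed (use assms in simp)

section \<open>The Bayesian model\<close>

text \<open>The joint law of \<open>(\<theta>, X)\<close> is disintegrated in both directions:
  \<open>likelihood\<close> conditions on the parameter, \<open>posterior\<close> on the
  data.\<close>

locale bayes_model = P: prob_space P + \<mu>: sigma_finite_measure \<mu>
  for P :: "'w measure" and \<mu> :: "'x measure" +
  fixes \<nu> :: "'t measure" and f :: "'t \<Rightarrow> 'x \<Rightarrow> ennreal" and T :: "'x \<Rightarrow> real"
    and \<theta> :: "'w \<Rightarrow> 't" and X :: "'w \<Rightarrow> 'x" and post :: "'x \<Rightarrow> 't measure"
  assumes T[measurable]: "T \<in> borel_measurable \<mu>"
    and f[measurable]: "(\<lambda>(t, x). f t x) \<in> borel_measurable (\<nu> \<Otimes>\<^sub>M \<mu>)"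
    and likelihood: "cond_distr P \<nu> \<theta> \<mu> X (\<lambda>t. density \<mu> (f t))"
    and posterior: "cond_distr P \<mu> X \<nu> \<theta> post"
begin

section \<open>Tail probabilities under the likelihood and under the predictive law\<close>

definition tail :: "'x \<Rightarrow> 'x set" where
  "tail x = {x' \<in> space \<mu>. T x \<le> T x'}"

text \<open>The p-value of \<open>x\<close> if the parameter were known to be
  \<open>t\<close>.\<close>

definition tail_prob :: "'t \<Rightarrow> 'x \<Rightarrow> real" where
  "tail_prob t x = measure (density \<mu> (f t)) (tail x)"

definition ppd_tail_prob :: "'x \<Rightarrow> real" where
  "ppd_tail_prob x = measure (ppd \<mu> f (post x)) (tail x)"

lemma X[measurable]: "X \<in> measurable P \<mu>" and \<theta>[measurable]: "\<theta> \<in> measurable P \<nu>"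
  using posterior by (simp_all add: cond_distr_def)

lemma sets_tail[measurable]: "tail x \<in> sets \<mu>"
  unfolding tail_def by measurable

lemma f_section: "t \<in> space \<nu> \<Longrightarrow> f t \<in> borel_measurable \<mu>"
  using measurable_Pair2[OF f, of t] by simp

lemma prob_space_density: "t \<in> space \<nu> \<Longrightarrow> prob_space (density \<mu> (f t))"
  using likelihood measurable_space[of "\<lambda>t. density \<mu> (f t)" \<nu> "prob_algebra \<mu>" t]
  by (auto simp: cond_distr_def space_prob_algebra)

lemma prob_space_post: "x \<in> space \<mu> \<Longrightarrow> prob_space (post x)"
  and sets_post: "x \<in> space \<mu> \<Longrightarrow> sets (post x) = sets \<nu>"
  using posterior measurable_space[of post \<mu> "prob_algebra \<nu>" x]
  by (auto simp: cond_distr_def space_prob_algebra)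

lemma space_post: "x \<in> space \<mu> \<Longrightarrow> space (post x) = space \<nu>"
  by (rule sets_eq_imp_space_eq, rule sets_post)

lemma ennreal_tail_prob:
  assumes "t \<in> space \<nu>"
  shows "ennreal (tail_prob t x) = emeasure (density \<mu> (f t)) (tail x)"
  unfolding tail_prob_def
  using prob_space_density[OF assms]
  by (simp add: finite_measure.emeasure_eq_measure prob_space.finite_measure)

lemma tail_prob_01: "t \<in> space \<nu> \<Longrightarrow> tail_prob t x \<in> {0..1}"
  using prob_space.prob_le_1[OF prob_space_density] by (simp add: tail_prob_def)

text \<open>Both the density and the tail set vary, so the value is rewritten as a parametrised
  integral over the fixed measure \<open>\<mu>\<close>. Joint measurability is what the
  disintegration lemma requires.\<close>

lemma borel_measurable_tail_prob[measurable]: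
  "(\<lambda>(t, x). tail_prob t x) \<in> borel_measurable (\<nu> \<Otimes>\<^sub>M \<mu>)"
proof -
  have [measurable]: "(\<lambda>(z, x'). f (fst z) x' * indicator {x'. T (snd z) \<le> T x'} x')
      \<in> borel_measurable ((\<nu> \<Otimes>\<^sub>M \<mu>) \<Otimes>\<^sub>M \<mu>)"
  proof -
    have "(\<lambda>z. (\<lambda>(t, x). f t x) (fst (fst z), snd z)) \<in> borel_measurable ((\<nu> \<Otimes>\<^sub>M \<mu>) \<Otimes>\<^sub>M \<mu>)"
      by measurable
    moreover have "(\<lambda>z. indicator {z. T (snd (fst z)) \<le> T (snd z)} z :: ennreal)
        \<in> borel_measurable ((\<nu> \<Otimes>\<^sub>M \<mu>) \<Otimes>\<^sub>M \<mu>)"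
      by measurable
    ultimately have "(\<lambda>z. (\<lambda>(t, x). f t x) (fst (fst z), snd z)
        * indicator {z. T (snd (fst z)) \<le> T (snd z)} z) \<in> borel_measurable ((\<nu> \<Otimes>\<^sub>M \<mu>) \<Otimes>\<^sub>M \<mu>)"
      by (rule borel_measurable_times_ennreal)
    then show ?thesis by (simp add: split_beta' indicator_def)
  qed
  have "(\<lambda>z. enn2real (\<integral>\<^sup>+x'. f (fst z) x' * indicator {x'. T (snd z) \<le> T x'} x' \<partial>\<mu>))
      \<in> borel_measurable (\<nu> \<Otimes>\<^sub>M \<mu>)"
    by measurable
  also have "?this \<longleftrightarrow> ?thesis"
  proof (rule measurable_cong)
    fix z assume "z \<in> space (\<nu> \<Otimes>\<^sub>M \<mu>)"
    then have t: "fst z \<in> space \<nu>" by (auto simp: space_pair_measure)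
    have "(\<integral>\<^sup>+x'. f (fst z) x' * indicator {x'. T (snd z) \<le> T x'} x' \<partial>\<mu>)
        = (\<integral>\<^sup>+x'. f (fst z) x' * indicator (tail (snd z)) x' \<partial>\<mu>)"
      by (intro nn_integral_cong) (auto simp: tail_def split: split_indicator)
    also have "\<dots> = emeasure (density \<mu> (f (fst z))) (tail (snd z))"
      by (rule emeasure_density[symmetric]) (simp_all add: f_section t)
    also have "\<dots> = ennreal (tail_prob (fst z) (snd z))"
      by (rule ennreal_tail_prob[OF t, symmetric])
    finally show "enn2real (\<integral>\<^sup>+x'. f (fst z) x' * indicator {x'. T (snd z) \<le> T x'} x' \<partial>\<mu>)
        = (\<lambda>(t, x). tail_prob t x) z"
      by (simp add: split_beta' tail_prob_def)
  qed
  finally show ?thesis .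
qed

text \<open>Tonelli: integrating the averaged density amounts to averaging the measures, which is
  the two-stage description of predictive sampling.\<close>

lemma emeasure_ppd:
  assumes x: "x \<in> space \<mu>" and A[measurable]: "A \<in> sets \<mu>"
  shows "emeasure (ppd \<mu> f (post x)) A = (\<integral>\<^sup>+t. emeasure (density \<mu> (f t)) A \<partial>post x)"
proof -
  interpret post: prob_space "post x" by (rule prob_space_post[OF x])
  interpret pair_sigma_finite "post x" \<mu> ..
  have [measurable_cong]: "sets (post x) = sets \<nu>" by (rule sets_post[OF x])
  have f'[measurable]: "(\<lambda>(t, x). f t x) \<in> borel_measurable (post x \<Otimes>\<^sub>M \<mu>)"
    by measurable
  have fA[measurable]: "(\<lambda>(t, x'). f t x' * indicator A x') \<in> borel_measurable (post x \<Otimes>\<^sub>M \<mu>)"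
    by measurable
  have dens: "ppd_density f (post x) \<in> borel_measurable \<mu>"
    unfolding ppd_density_def[abs_def] by measurable
  have "emeasure (ppd \<mu> f (post x)) A = (\<integral>\<^sup>+y. ppd_density f (post x) y * indicator A y \<partial>\<mu>)"
    unfolding ppd_def by (rule emeasure_density[OF dens A])
  also have "\<dots> = (\<integral>\<^sup>+y. \<integral>\<^sup>+t. f t y * indicator A y \<partial>post x \<partial>\<mu>)"
  proof (rule nn_integral_cong)
    fix y assume y: "y \<in> space \<mu>"
    have "(\<lambda>t. f t y) \<in> borel_measurable (post x)"
      using measurable_Pair1[OF f' y] by simp
    then show "ppd_density f (post x) y * indicator A y = (\<integral>\<^sup>+t. f t y * indicator A y \<partial>post x)"
      unfolding ppd_density_def by (rule nn_integral_multc[symmetric])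
  qed
  also have "\<dots> = (\<integral>\<^sup>+t. \<integral>\<^sup>+y. f t y * indicator A y \<partial>\<mu> \<partial>post x)"
    by (rule Fubini') (use fA in simp)
  also have "\<dots> = (\<integral>\<^sup>+t. emeasure (density \<mu> (f t)) A \<partial>post x)"
    by (intro nn_integral_cong emeasure_density[symmetric])
      (simp_all add: f_section space_post[OF x])
  finally show ?thesis .
qed

lemma prob_space_ppd:
  assumes x: "x \<in> space \<mu>"
  shows "prob_space (ppd \<mu> f (post x))"
proof
  have "emeasure (ppd \<mu> f (post x)) (space \<mu>) = (\<integral>\<^sup>+t. 1 \<partial>post x)"
    unfolding emeasure_ppd[OF x sets.top]
    using prob_space.emeasure_space_1[OF prob_space_density] space_post[OF x]
    by (intro nn_integral_cong) simp
  then show "emeasure (ppd \<mu> f (post x)) (space (ppd \<mu> f (post x))) = 1"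
    using prob_space.emeasure_space_1[OF prob_space_post[OF x]] by (simp add: ppd_def)
qed

lemma ppd_tail_prob_01: "x \<in> space \<mu> \<Longrightarrow> ppd_tail_prob x \<in> {0..1}"
  using prob_space.prob_le_1[OF prob_space_ppd] by (simp add: ppd_tail_prob_def)

lemma tail_prob_section:
  assumes x: "x \<in> space \<mu>"
  shows "(\<lambda>t. tail_prob t x) \<in> borel_measurable (post x)"
  using measurable_Pair1[OF borel_measurable_tail_prob x]
  by (simp add: measurable_cong_sets[OF sets_post[OF x] refl])

lemma integrable_tail_prob:
  assumes x: "x \<in> space \<mu>"
  shows "integrable (post x) (\<lambda>t. tail_prob t x)"
proof -
  interpret post: prob_space "post x" by (rule prob_space_post[OF x])
  show ?thesis
    by (rule post.integrable_const_bound[of _ 1, OF _ tail_prob_section[OF x]])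
      (use tail_prob_01 space_post[OF x] in \<open>auto intro!: AE_I2\<close>)
qed

text \<open>The mixture formula at the observed tail. The Bochner integral is used because
  supporting lines may take negative values.\<close>

lemma ppd_tail_prob_eq:
  assumes x: "x \<in> space \<mu>"
  shows "ppd_tail_prob x = (\<integral>t. tail_prob t x \<partial>post x)"
proof -
  have "ennreal (ppd_tail_prob x) = emeasure (ppd \<mu> f (post x)) (tail x)"
    unfolding ppd_tail_prob_def using prob_space_ppd[OF x]
    by (simp add: finite_measure.emeasure_eq_measure prob_space.finite_measure)
  also have "\<dots> = (\<integral>\<^sup>+t. ennreal (tail_prob t x) \<partial>post x)"
    unfolding emeasure_ppd[OF x sets_tail]
    by (intro nn_integral_cong) (simp add: ennreal_tail_prob space_post[OF x])
  also have "\<dots> = ennreal (\<integral>t. tail_prob t x \<partial>post x)"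
    by (intro nn_integral_eq_integral integrable_tail_prob x) (simp add: tail_prob_def)
  finally show ?thesis
    by (subst (asm) ennreal_inj) (auto simp: ppd_tail_prob_def tail_prob_def intro!: integral_nonneg)
qed

section \<open>Convex moments of the predictive tail probability\<close>

lemma ppd_tail_prob_jensen:
  assumes x: "x \<in> space \<mu>"
    and \<psi>[measurable]: "\<psi> \<in> borel_measurable borel" and anti: "antimono_on {0..1} \<psi>"
    and nonneg: "\<And>u. u \<in> {0..1} \<Longrightarrow> 0 \<le> \<psi> u"
    and tangent: "\<And>p. p \<in> {0..1} \<Longrightarrow> \<exists>c. \<forall>q\<in>{0..1}. \<psi> p + c * (q - p) \<le> \<psi> q"
  shows "ennreal (\<psi> (ppd_tail_prob x)) \<le> (\<integral>\<^sup>+t. ennreal (\<psi> (tail_prob t x)) \<partial>post x)"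
proof -
  interpret post: prob_space "post x" by (rule prob_space_post[OF x])
  note [measurable] = tail_prob_section[OF x]
  note int = integrable_tail_prob[OF x]
  let ?p = "ppd_tail_prob x"
  \<comment> \<open>Jensen by a supporting line at the posterior mean \<open>?p\<close>; the
    assumption provides one at the endpoints 0 and 1 too.\<close>
  obtain c where c: "\<And>q. q \<in> {0..1} \<Longrightarrow> \<psi> ?p + c * (q - ?p) \<le> \<psi> q"
    using tangent[OF ppd_tail_prob_01[OF x]] by blast
  \<comment> \<open>A nonnegative decreasing function is bounded by its value at 0, which gives
    integrability.\<close>
  have \<psi>0: "\<psi> q \<le> \<psi> 0" if "q \<in> {0..1}" for q
    using anti that by (auto simp: monotone_on_def)
  have t01: "tail_prob t x \<in> {0..1}" if "t \<in> space (post x)" for t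
    using that by (simp add: tail_prob_01 space_post[OF x] del: atLeastAtMost_iff)
  have int\<psi>: "integrable (post x) (\<lambda>t. \<psi> (tail_prob t x))"
    by (rule post.integrable_const_bound[of _ "\<psi> 0"])
      (use \<psi>0 nonneg t01 in \<open>auto intro!: AE_I2 simp del: atLeastAtMost_iff\<close>)
  \<comment> \<open>The linear term integrates to zero, since \<open>?p\<close> is the mean of
    \<open>tail_prob t x\<close>.\<close>
  have "\<psi> ?p = (\<integral>t. \<psi> ?p + c * (tail_prob t x - ?p) \<partial>post x)"
    using int by (simp add: ppd_tail_prob_eq[OF x] post.prob_space)
  also have "\<dots> \<le> (\<integral>t. \<psi> (tail_prob t x) \<partial>post x)"
    using int int\<psi> c t01 by (intro integral_mono) auto
  finally have "ennreal (\<psi> ?p) \<le> ennreal (\<integral>t. \<psi> (tail_prob t x) \<partial>post x)"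
    by (rule ennreal_leI)
  also have "\<dots> = (\<integral>\<^sup>+t. ennreal (\<psi> (tail_prob t x)) \<partial>post x)"
    using int\<psi> nonneg t01 by (intro nn_integral_eq_integral[symmetric] AE_I2) auto
  finally show ?thesis .
qed

text \<open>Jensen is applied given the data, super-uniformity given the parameter. In between,
  \<open>posterior\<close> turns the iterated integral into one over the joint law of
  \<open>(\<theta>, X)\<close>, and \<open>likelihood\<close> conditions that law the other
  way.\<close>

lemma ppd_tail_prob_moment_le:
  assumes \<psi>[measurable]: "\<psi> \<in> borel_measurable borel" and anti: "antimono_on {0..1} \<psi>"
    and nonneg: "\<And>u. u \<in> {0..1} \<Longrightarrow> 0 \<le> \<psi> u"
    and tangent: "\<And>p. p \<in> {0..1} \<Longrightarrow> \<exists>c. \<forall>q\<in>{0..1}. \<psi> p + c * (q - p) \<le> \<psi> q"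
  shows "(\<integral>\<^sup>+\<omega>. ennreal (\<psi> (ppd_tail_prob (X \<omega>))) \<partial>P)
    \<le> (\<integral>\<^sup>+u. ennreal (\<psi> u) * indicator {0..1} u \<partial>lborel)" (is "_ \<le> ?U")
proof -
  have swap: "(\<lambda>(x, t). tail_prob t x) \<in> borel_measurable (\<mu> \<Otimes>\<^sub>M \<nu>)"
    using measurable_pair_swap[OF borel_measurable_tail_prob] by (simp add: split_beta')
  have h1: "(\<lambda>z. ennreal (\<psi> (tail_prob (snd z) (fst z)))) \<in> borel_measurable (\<mu> \<Otimes>\<^sub>M \<nu>)"
    using swap by (simp add: split_beta')
  have h2: "(\<lambda>z. ennreal (\<psi> (tail_prob (fst z) (snd z)))) \<in> borel_measurable (\<nu> \<Otimes>\<^sub>M \<mu>)"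
    using borel_measurable_tail_prob by (simp add: split_beta')
  have "(\<integral>\<^sup>+\<omega>. ennreal (\<psi> (ppd_tail_prob (X \<omega>))) \<partial>P)
      \<le> (\<integral>\<^sup>+\<omega>. (\<integral>\<^sup>+t. ennreal (\<psi> (tail_prob t (X \<omega>))) \<partial>post (X \<omega>)) \<partial>P)"
    by (intro nn_integral_mono ppd_tail_prob_jensen assms measurable_space[OF X])
  also have "\<dots> = (\<integral>\<^sup>+\<omega>. ennreal (\<psi> (tail_prob (\<theta> \<omega>) (X \<omega>))) \<partial>P)"
    using cond_distr_nn_integral[OF P.prob_space_axioms posterior h1] by simp
  also have "\<dots> = (\<integral>\<^sup>+\<omega>. (\<integral>\<^sup>+x. ennreal (\<psi> (tail_prob (\<theta> \<omega>) x)) \<partial>density \<mu> (f (\<theta> \<omega>))) \<partial>P)"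
    using cond_distr_nn_integral[OF P.prob_space_axioms likelihood h2] by simp
  also have "\<dots> \<le> (\<integral>\<^sup>+\<omega>. ?U \<partial>P)"
  proof (rule nn_integral_mono)
    fix \<omega> assume "\<omega> \<in> space P"
    then have t: "\<theta> \<omega> \<in> space \<nu>" by (rule measurable_space[OF \<theta>])
    let ?D = "density \<mu> (f (\<theta> \<omega>))"
    have D: "prob_space ?D" by (rule prob_space_density[OF t])
    show "(\<integral>\<^sup>+x. ennreal (\<psi> (tail_prob (\<theta> \<omega>) x)) \<partial>?D) \<le> ?U"
    proof (rule superuniform_antimono_integral_le[OF D _ _ _ \<psi> anti])
      show "tail_prob (\<theta> \<omega>) \<in> borel_measurable ?D"
        using measurable_Pair2[OF borel_measurable_tail_prob t] by simp
      show "emeasure ?D {x \<in> space ?D. tail_prob (\<theta> \<omega>) x \<le> u} \<le> ennreal u" for u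
        using superuniform_tail_probability[OF D, of T u] by (simp add: tail_prob_def tail_def)
    qed (rule tail_prob_01[OF t])
  qed
  also have "\<dots> = ?U" by (simp add: P.emeasure_space_1)
  finally show ?thesis .
qed

section \<open>Tail bounds for the two p-values\<close>

lemma pval_inf_prob_le:
  assumes "0 \<le> \<alpha>"
  shows "measure P {\<omega> \<in> space P. pval_inf T (ppd \<mu> f (post (X \<omega>))) (X \<omega>) \<le> \<alpha>} \<le> 2 * \<alpha>"
proof (rule P.prob_le_twice_if_moment_bound[OF _ assms])
  fix a :: real assume a: "0 < a"
  have eq: "pval_inf T (ppd \<mu> f (post x)) x = ppd_tail_prob x" for x
    by (simp add: pval_inf_def ppd_tail_prob_def tail_def ppd_def)
  have "(\<integral>\<^sup>+\<omega>. ennreal (max 0 (2 * a - ppd_tail_prob (X \<omega>))) \<partial>P)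
      \<le> (\<integral>\<^sup>+u. ennreal (max 0 (2 * a - u)) * indicator {0..1} u \<partial>lborel)"
  proof (rule ppd_tail_prob_moment_le)
    fix p :: real
    show "\<exists>c. \<forall>q\<in>{0..1}. max 0 (2 * a - p) + c * (q - p) \<le> max 0 (2 * a - q)"
      \<comment> \<open>Slope -1 left of the kink at \<open>2 * a\<close>, slope 0 from the kink
        on.\<close>
      by (rule exI[of _ "if p < 2 * a then - 1 else 0"]) auto
  qed (auto simp: monotone_on_def)
  also have "\<dots> \<le> ennreal (2 * a\<^sup>2)" by (rule nn_integral_hinge_le[OF a])
  finally show "(\<integral>\<^sup>+\<omega>. ennreal (max 0 (2 * a - pval_inf T (ppd \<mu> f (post (X \<omega>))) (X \<omega>))) \<partial>P)
      \<le> ennreal (2 * a\<^sup>2)"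
    by (simp add: eq)
qed

lemma pval_fin_prob_le:
  assumes Xs: "cond_distr P \<mu> X (\<Pi>\<^sub>M i\<in>{1..m}. \<mu>) (\<lambda>\<omega>. \<lambda>i\<in>{1..m}. Xs i \<omega>)
      (\<lambda>x. \<Pi>\<^sub>M i\<in>{1..m}. ppd \<mu> f (post x))"
    and "0 \<le> \<alpha>"
  shows "measure P {\<omega> \<in> space P. pval_fin T m (X \<omega>) (\<lambda>i. Xs i \<omega>) \<le> \<alpha>} \<le> 2 * \<alpha>"
proof (rule P.prob_le_twice_if_moment_bound[OF _ assms(2)])
  fix a :: real assume a: "0 < a"
  \<comment> \<open>The hinge at the p-value produced by \<open>k\<close> hits.\<close>
  define \<phi> where "\<phi> k = max 0 (2 * a - (1 + real k) / (real m + 1))" for k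
  have \<phi>0: "0 \<le> \<phi> k" for k by (simp add: \<phi>_def)
  define h where "h = (\<lambda>(x, xs). ennreal (\<phi> (\<Sum>i\<in>{1..m}. of_bool (T x \<le> T (xs i)))))"
  have h: "h \<in> borel_measurable (\<mu> \<Otimes>\<^sub>M (\<Pi>\<^sub>M i\<in>{1..m}. \<mu>))"
  proof -
    have "(\<lambda>z. \<Sum>i\<in>{1..m}. of_bool (T (fst z) \<le> T (snd z i)) :: nat)
        \<in> measurable (\<mu> \<Otimes>\<^sub>M (\<Pi>\<^sub>M i\<in>{1..m}. \<mu>)) (count_space UNIV)"
    proof (rule measurable_sum_nat)
      fix i assume i: "i \<in> {1..m}"
      have [measurable]: "(\<lambda>z. snd z i) \<in> measurable (\<mu> \<Otimes>\<^sub>M (\<Pi>\<^sub>M i\<in>{1..m}. \<mu>)) \<mu>"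
        using i by measurable
      show "(\<lambda>z. of_bool (T (fst z) \<le> T (snd z i)) :: nat)
          \<in> measurable (\<mu> \<Otimes>\<^sub>M (\<Pi>\<^sub>M i\<in>{1..m}. \<mu>)) (count_space UNIV)"
        by measurable
    qed
    then show ?thesis unfolding h_def split_beta' by measurable
  qed
  have "(\<integral>\<^sup>+\<omega>. ennreal (max 0 (2 * a - pval_fin T m (X \<omega>) (\<lambda>i. Xs i \<omega>))) \<partial>P)
      = (\<integral>\<^sup>+\<omega>. h (X \<omega>, \<lambda>i\<in>{1..m}. Xs i \<omega>) \<partial>P)"
  proof (rule nn_integral_cong)
    fix \<omega>
    have "(\<Sum>i=1..m. of_bool (T (X \<omega>) \<le> T ((\<lambda>i\<in>{1..m}. Xs i \<omega>) i)))
        = (\<Sum>i=1..m. of_bool (T (X \<omega>) \<le> T (Xs i \<omega>)) :: nat)"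
      by (rule sum.cong) auto
    then show "ennreal (max 0 (2 * a - pval_fin T m (X \<omega>) (\<lambda>i. Xs i \<omega>)))
        = h (X \<omega>, \<lambda>i\<in>{1..m}. Xs i \<omega>)"
      by (simp add: h_def \<phi>_def pval_fin_def del: restrict_apply)
  qed
  also have "\<dots> = (\<integral>\<^sup>+\<omega>. (\<integral>\<^sup>+xs. h (X \<omega>, xs) \<partial>(\<Pi>\<^sub>M i\<in>{1..m}. ppd \<mu> f (post (X \<omega>)))) \<partial>P)"
    by (rule cond_distr_nn_integral[OF P.prob_space_axioms Xs h])
  also have "\<dots> = (\<integral>\<^sup>+\<omega>. ennreal (binom_mean m \<phi> (ppd_tail_prob (X \<omega>))) \<partial>P)"
  proof (rule nn_integral_cong)
    fix \<omega> assume "\<omega> \<in> space P"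
    then have x: "X \<omega> \<in> space \<mu>" by (rule measurable_space[OF X])
    let ?D = "ppd \<mu> f (post (X \<omega>))"
    have "(\<integral>\<^sup>+xs. h (X \<omega>, xs) \<partial>(\<Pi>\<^sub>M i\<in>{1..m}. ?D))
      = (\<integral>\<^sup>+xs. ennreal (\<phi> (\<Sum>i\<in>{1..m}. of_bool (xs i \<in> tail (X \<omega>)))) \<partial>(\<Pi>\<^sub>M i\<in>{1..m}. ?D))"
    proof (rule nn_integral_cong)
      fix xs assume "xs \<in> space (\<Pi>\<^sub>M i\<in>{1..m}. ?D)"
      then have "xs i \<in> space \<mu>" if "i \<in> {1..m}" for i
        using that by (auto simp: space_PiM ppd_def)
      then have "(\<Sum>i\<in>{1..m}. of_bool (T (X \<omega>) \<le> T (xs i)))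
          = (\<Sum>i\<in>{1..m}. of_bool (xs i \<in> tail (X \<omega>)) :: nat)"
        by (intro sum.cong) (auto simp: tail_def)
      then show "h (X \<omega>, xs) = ennreal (\<phi> (\<Sum>i\<in>{1..m}. of_bool (xs i \<in> tail (X \<omega>))))"
        by (simp add: h_def)
    qed
    also have "\<dots> = ennreal (binom_mean m \<phi> (ppd_tail_prob (X \<omega>)))"
      using nn_integral_PiM_count[OF prob_space_ppd[OF x], of "tail (X \<omega>)" "{1..m}" \<phi>] \<phi>0
      by (simp add: ppd_tail_prob_def ppd_def)
    finally show "(\<integral>\<^sup>+xs. h (X \<omega>, xs) \<partial>(\<Pi>\<^sub>M i\<in>{1..m}. ?D))
      = ennreal (binom_mean m \<phi> (ppd_tail_prob (X \<omega>)))" .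
  qed
  also have "\<dots> \<le> (\<integral>\<^sup>+u. ennreal (binom_mean m \<phi> u) * indicator {0..1} u \<partial>lborel)"
  proof (rule ppd_tail_prob_moment_le)
    have step: "(1 + real (Suc k)) / (real m + 1) = (1 + real k) / (real m + 1) + 1 / (real m + 1)" for k
      by (simp add: add_divide_distrib)
    have pos: "0 \<le> 1 / (real m + 1)" by simp
    have "\<phi> (Suc k) \<le> \<phi> k" for k
      using pos unfolding \<phi>_def step by linarith
    then show "antimono_on {0..1} (binom_mean m \<phi>)"
      by (rule binom_mean_antimono)
    \<comment> \<open>Midpoint convexity of the hinge at three equally spaced points; here the
      spacing is \<open>1 / (real m + 1)\<close>.\<close>
    have "2 * max 0 (x - (y + d)) \<le> max 0 (x - y) + max 0 (x - (y + d + d))"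
      if "0 \<le> d" for x y d :: real
      using that by (auto simp: max_def)
    then have convex: "2 * \<phi> (Suc k) \<le> \<phi> k + \<phi> (Suc (Suc k))" for k
      using pos unfolding \<phi>_def step by blast
    show "\<exists>c. \<forall>q\<in>{0..1}. binom_mean m \<phi> p + c * (q - p) \<le> binom_mean m \<phi> q"
      if "p \<in> {0..1}" for p
      using binom_mean_above_tangent[of \<phi>, OF convex that] by blast
  qed (simp_all add: binom_mean_nonneg \<phi>0)
  \<comment> \<open>With a uniform success probability, the binomial count is uniform on
    \<open>{0..m}\<close>.\<close>
  also have "\<dots> = ennreal ((\<Sum>k\<le>m. \<phi> k) / real (Suc m))"
    by (rule nn_integral_binom_mean[OF \<phi>0])
  also have "\<dots> \<le> ennreal (2 * a\<^sup>2)"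
  proof (rule ennreal_leI)
    \<comment> \<open>Scaling by \<open>n = m + 1\<close>, the number of possible counts, turns
      p-values into the integers \<open>1 + k\<close>, so \<open>sum_hinge_le\<close> applies with
      \<open>b = 2 * a * n\<close>.\<close>
    define n where "n = real (Suc m)"
    have n: "0 < n" by (simp add: n_def)
    have "(\<Sum>k\<le>m. \<phi> k) = (\<Sum>k<Suc m. max 0 (2 * a * n - (1 + real k)) / n)"
      unfolding lessThan_Suc_atMost
    proof (rule sum.cong)
      fix k
      have "\<phi> k = max 0 ((2 * a * n - (1 + real k)) / n)"
        using n by (simp add: \<phi>_def n_def diff_divide_distrib add.commute)
      then show "\<phi> k = max 0 (2 * a * n - (1 + real k)) / n"
        using n by (simp add: max_def zero_le_divide_iff)
    qed simp
    also have "\<dots> = (\<Sum>k<Suc m. max 0 (2 * a * n - (1 + real k))) / n"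
      by (rule sum_divide_distrib[symmetric])
    also have "\<dots> \<le> ((2 * a * n)\<^sup>2 / 2) / n"
      using sum_hinge_le[of "2 * a * n" "Suc m"] a n
      by (intro divide_right_mono) (auto simp del: sum.lessThan_Suc intro: order_trans)
    also have "\<dots> = 2 * a\<^sup>2 * n" using n by (simp add: power2_eq_square)
    finally show "(\<Sum>k\<le>m. \<phi> k) / real (Suc m) \<le> 2 * a\<^sup>2"
      using n by (simp add: n_def divide_le_eq)
  qed
  finally show "(\<integral>\<^sup>+\<omega>. ennreal (max 0 (2 * a - pval_fin T m (X \<omega>) (\<lambda>i. Xs i \<omega>))) \<partial>P)
      \<le> ennreal (2 * a\<^sup>2)" .
qed

end

text \<open>Conditional i.i.d. sampling is encoded by a product kernel: given \<open>X\<close>, the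
  whole \<open>m\<close>-tuple has the \<open>m\<close>-fold product of the predictive distribution
  as its law.\<close>

theorem proposition7:
  fixes \<nu> :: "'t measure" and \<mu> :: "'x measure" and f :: "'t \<Rightarrow> 'x \<Rightarrow> ennreal"
    and T :: "'x \<Rightarrow> real" and P :: "'w measure"
    and \<theta> :: "'w \<Rightarrow> 't" and X :: "'w \<Rightarrow> 'x" and post :: "'x \<Rightarrow> 't measure"
  assumes "standard_borel \<mu>" and "sigma_finite_measure \<mu>"
    and "T \<in> borel_measurable \<mu>"
    and "prob_space \<nu>"
    and "(\<lambda>(t, x). f t x) \<in> borel_measurable (\<nu> \<Otimes>\<^sub>M \<mu>)"
    and "\<And>t. t \<in> space \<nu> \<Longrightarrow> (\<integral>\<^sup>+x. f t x \<partial>\<mu>) = 1"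
    and "prob_space P"
    and "\<theta> \<in> measurable P \<nu>" and "distr P \<nu> \<theta> = \<nu>"
    and "cond_distr P \<nu> \<theta> \<mu> X (\<lambda>t. density \<mu> (f t))"
    and "cond_distr P \<mu> X \<nu> \<theta> post"
  shows "(\<forall>m\<ge>1. \<forall>Xs :: nat \<Rightarrow> 'w \<Rightarrow> 'x.
            cond_distr P \<mu> X (\<Pi>\<^sub>M i\<in>{1..m}. \<mu>) (\<lambda>\<omega>. \<lambda>i\<in>{1..m}. Xs i \<omega>)
              (\<lambda>x. \<Pi>\<^sub>M i\<in>{1..m}. ppd \<mu> f (post x)) \<longrightarrow>
            (\<forall>\<alpha>\<in>{0..1}. measure P {\<omega> \<in> space P.
               pval_fin T m (X \<omega>) (\<lambda>i. Xs i \<omega>) \<le> \<alpha>} \<le> 2 * \<alpha>)) \<and>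
         (\<forall>\<alpha>\<in>{0..1}. measure P {\<omega> \<in> space P.
            pval_inf T (ppd \<mu> f (post (X \<omega>))) (X \<omega>) \<le> \<alpha>} \<le> 2 * \<alpha>)"
proof -
  interpret bayes_model P \<mu> \<nu> f T \<theta> X post
    using assms by (intro bayes_model.intro bayes_model_axioms.intro)
  show ?thesis using pval_fin_prob_le pval_inf_prob_le by simp
qed

end
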